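(* Let $a, b \in \mathbb{R}$. Put $\alpha = a/2$ and $\beta = \sqrt{|a^2/4 - b|}$. Then all solutions $y : \mathbb{R} \to \mathbb{R}$ of the differential equation $y'' + a y' + b y = 0$ are given as follows; that is, a function $y : \mathbb{R} \to \mathbb{R}$ is a solution if and only if there exist $C_1, C_2 \in \mathbb{R}$ such that, for all $x \in \mathbb{R}$: (1) $y(x) = e^{-\alpha x}\left( C_1 \cosh(\beta x) + C_2 \sinh(\beta x) \right)$, if $a^2/4 > b$; (2) $y(x) = e^{-\alpha x}\left( C_1 + C_2 x \right)$, if $a^2/4 = b$; (3) $y(x) = e^{-\alpha x}\left( C_1 \cos(\beta x) + C_2 \sin(\beta x) \right)$, if $a^2/4 < b$.
   Context: A solution of $y'' + a y' + b y = 0$ means a twice differentiable function $y : \mathbb{R} \to \mathbb{R}$ of the real variable $x$ satisfying $y''(x) + a y'(x) + b y(x) = 0$ for every $x \in \mathbb{R}$. *)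

theory Defs
  imports "HOL-Analysis.Analysis"
begin

text \<open>Differentiability is required explicitly because \<^const>\<open>deriv\<close> is a total operator
  with an unspecified value where the derivative does not exist.\<close>

definition twice_differentiable :: "(real \<Rightarrow> real) \<Rightarrow> bool" where
  "twice_differentiable y \<longleftrightarrow>
     (\<forall>x. y differentiable (at x)) \<and> (\<forall>x. deriv y differentiable (at x))"

definition ode_solution :: "real \<Rightarrow> real \<Rightarrow> (real \<Rightarrow> real) \<Rightarrow> bool" where
  "ode_solution a b y \<longleftrightarrow>
     twice_differentiable y \<and>
     (\<forall>x. deriv (deriv y) x + a * deriv y x + b * y x = 0)"

end

theory Submission
  imports Defs
begin

text \<open>Substituting $y = e^{-\alpha x} z$ turns the equation into $z'' = k z$ with $k = a^2/4 - b$.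
  If $c' = k s$, $s' = c$ and $c^2 - k s^2 = 1$, then $c z - s z'$ and $c z' - k s z$ are constant
  along every solution, and solving these two linear relations for $z$ gives
  $z = C_1 c + C_2 s$. The three cases are three choices of $(c, s)$.\<close>

text \<open>Naming the first derivative \<open>y'\<close> replaces \<open>deriv\<close> by two
  first-order statements, which the derivative rules can use and prove directly. Uniqueness of
  derivatives identifies \<open>y'\<close> with \<open>deriv y\<close> in the converse.\<close>

lemma ode_solution_iff_has_derivatives:
  "ode_solution a b y \<longleftrightarrow>
     (\<exists>y'. (\<forall>x. (y has_real_derivative y' x) (at x)) \<and>
           (\<forall>x. (y' has_real_derivative - a * y' x - b * y x) (at x)))"
proof
  assume sol: "ode_solution a b y"
  have "(y has_real_derivative deriv y x) (at x)" for x
    using sol unfolding ode_solution_def twice_differentiable_def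
    by (simp add: DERIV_deriv_iff_real_differentiable)
  moreover have "(deriv y has_real_derivative - a * deriv y x - b * y x) (at x)" for x
  proof -
    have "(deriv y has_real_derivative deriv (deriv y) x) (at x)"
      using sol unfolding ode_solution_def twice_differentiable_def
      by (simp add: DERIV_deriv_iff_real_differentiable)
    moreover have "deriv (deriv y) x + a * deriv y x + b * y x = 0"
      using sol unfolding ode_solution_def by blast
    then have "deriv (deriv y) x = - a * deriv y x - b * y x"
      by linarith
    ultimately show ?thesis by simp
  qed
  ultimately show "\<exists>y'. (\<forall>x. (y has_real_derivative y' x) (at x)) \<and>
      (\<forall>x. (y' has_real_derivative - a * y' x - b * y x) (at x))"
    by blast
next
  assume "\<exists>y'. (\<forall>x. (y has_real_derivative y' x) (at x)) \<and>
      (\<forall>x. (y' has_real_derivative - a * y' x - b * y x) (at x))"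
  then obtain y' where y: "\<And>x. (y has_real_derivative y' x) (at x)"
    and y': "\<And>x. (y' has_real_derivative - a * y' x - b * y x) (at x)"
    by blast
  have deriv_y: "deriv y = y'"
    using y by (intro ext DERIV_imp_deriv)
  have "deriv y' x = - a * y' x - b * y x" for x
    using y' by (rule DERIV_imp_deriv)
  then show "ode_solution a b y"
    unfolding ode_solution_def twice_differentiable_def deriv_y
    using y y' by (auto simp: real_differentiable_def)
qed

text \<open>Keeping \<open>k\<close> of arbitrary sign treats all three cases at once. Since
  \<open>s' = c\<close> and \<open>c' = k s\<close>, the expression in \<open>wronskian\<close> is
  the Wronskian \<open>c s' - c' s\<close>. Explicit conserved quantities take the place of a
  uniqueness theorem.\<close>

lemma ode_solution_iff_fundamental_system:
  fixes a b k \<alpha> :: real and c s y :: "real \<Rightarrow> real"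
  assumes a: "a = 2 * \<alpha>" and b: "b = \<alpha>\<^sup>2 - k"
    and c: "\<And>x. (c has_real_derivative k * s x) (at x)"
    and s: "\<And>x. (s has_real_derivative c x) (at x)"
    and wronskian: "\<And>x. (c x)\<^sup>2 - k * (s x)\<^sup>2 = 1"
  shows "ode_solution a b y \<longleftrightarrow>
    (\<exists>C1 C2. \<forall>x. y x = exp (- \<alpha> * x) * (C1 * c x + C2 * s x))"
proof
  assume "ode_solution a b y"
  then obtain y' where y: "\<And>x. (y has_real_derivative y' x) (at x)"
    and y': "\<And>x. (y' has_real_derivative - a * y' x - b * y x) (at x)"
    unfolding ode_solution_iff_has_derivatives by blast
  \<comment> \<open>Undoes the exponential factor; \<open>z'\<close> is the derivative of
    \<open>z\<close> by the product rule.\<close>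
  define z z' where "z x = exp (\<alpha> * x) * y x"
    and "z' x = exp (\<alpha> * x) * (y' x + \<alpha> * y x)" for x
  have z: "(z has_real_derivative z' x) (at x)" for x
    unfolding z_def z'_def
    by (auto intro!: derivative_eq_intros y simp: algebra_simps)
  have z': "(z' has_real_derivative k * z x) (at x)" for x
    unfolding z_def z'_def a b
    by (auto intro!: derivative_eq_intros y y'[unfolded a b]
        simp: algebra_simps power2_eq_square)
  \<comment> \<open>This is \<open>s' z - s z'\<close>, the Wronskian of \<open>z\<close> and
    \<open>s\<close>. Its derivative \<open>s'' z - s z''\<close> vanishes because both satisfy the
    same equation without a first-order term. The next invariant is
    \<open>c z' - c' z\<close>.\<close>
  have "((\<lambda>x. c x * z x - s x * z' x) has_real_derivative 0) (at x)" for x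
    by (auto intro!: derivative_eq_intros c s z z' simp: algebra_simps)
  then obtain C1 where C1: "\<And>x. c x * z x - s x * z' x = C1"
    using DERIV_isconst_all by blast
  have "((\<lambda>x. c x * z' x - k * s x * z x) has_real_derivative 0) (at x)" for x
    by (auto intro!: derivative_eq_intros c s z z' simp: algebra_simps)
  then obtain C2 where C2: "\<And>x. c x * z' x - k * s x * z x = C2"
    using DERIV_isconst_all by blast
  have "y x = exp (- \<alpha> * x) * (C1 * c x + C2 * s x)" for x
  proof -
    \<comment> \<open>Eliminates \<open>z'\<close> from the two invariants: the terms in
      \<open>c s z'\<close> cancel.\<close>
    have "C1 * c x + C2 * s x = ((c x)\<^sup>2 - k * (s x)\<^sup>2) * z x"
      unfolding C1[of x, symmetric] C2[of x, symmetric]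
      by (simp add: algebra_simps power2_eq_square)
    then show ?thesis
      by (simp add: wronskian z_def exp_minus)
  qed
  then show "\<exists>C1 C2. \<forall>x. y x = exp (- \<alpha> * x) * (C1 * c x + C2 * s x)"
    by blast
next
  assume "\<exists>C1 C2. \<forall>x. y x = exp (- \<alpha> * x) * (C1 * c x + C2 * s x)"
  then obtain C1 C2 where "\<And>x. y x = exp (- \<alpha> * x) * (C1 * c x + C2 * s x)"
    by blast
  then have y: "y = (\<lambda>x. exp (- \<alpha> * x) * (C1 * c x + C2 * s x))"
    by blast
  \<comment> \<open>With \<open>z = C1 c + C2 s\<close>, this is
    \<open>exp (- \<alpha> * x) * (z' - \<alpha> * z)\<close>, the product-rule derivative of
    \<open>y\<close>.\<close>
  define y' where
    "y' x = exp (- \<alpha> * x) * (C1 * k * s x + C2 * c x - \<alpha> * (C1 * c x + C2 * s x))" for x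
  have "(y has_real_derivative y' x) (at x)" for x
    unfolding y y'_def
    by (auto intro!: derivative_eq_intros c s simp: algebra_simps)
  moreover have "(y' has_real_derivative - a * y' x - b * y x) (at x)" for x
    unfolding y y'_def a b
    by (auto intro!: derivative_eq_intros c s simp: algebra_simps power2_eq_square)
  ultimately show "ode_solution a b y"
    unfolding ode_solution_iff_has_derivatives by blast
qed

text \<open>The condition \<open>s' = c\<close> forces a factor \<open>1 / \<beta>\<close> on sinh
  and sin; the free constant \<open>C2\<close> absorbs it.\<close>

lemma ex_scaled_coefficient:
  fixes \<beta> :: real
  assumes "\<beta> \<noteq> 0"
  shows "(\<exists>C1 C2. \<forall>x. y x = e x * (C1 * c x + C2 * (s x / \<beta>))) \<longleftrightarrow>
         (\<exists>C1 C2. \<forall>x. y x = e x * (C1 * c x + C2 * s x))"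
proof
  assume "\<exists>C1 C2. \<forall>x. y x = e x * (C1 * c x + C2 * (s x / \<beta>))"
  then obtain C1 C2 where "\<forall>x. y x = e x * (C1 * c x + C2 * (s x / \<beta>))"
    by blast
  then have "\<forall>x. y x = e x * (C1 * c x + C2 / \<beta> * s x)"
    by simp
  then show "\<exists>C1 C2. \<forall>x. y x = e x * (C1 * c x + C2 * s x)"
    by blast
next
  assume "\<exists>C1 C2. \<forall>x. y x = e x * (C1 * c x + C2 * s x)"
  then obtain C1 C2 where "\<forall>x. y x = e x * (C1 * c x + C2 * s x)"
    by blast
  then have "\<forall>x. y x = e x * (C1 * c x + C2 * \<beta> * (s x / \<beta>))"
    using assms by simp
  then show "\<exists>C1 C2. \<forall>x. y x = e x * (C1 * c x + C2 * (s x / \<beta>))"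
    by blast
qed

theorem mainTheorem1:
  fixes a b \<alpha> \<beta> :: real and y :: "real \<Rightarrow> real"
  assumes "\<alpha> = a / 2"
    and "\<beta> = sqrt \<bar>a\<^sup>2 / 4 - b\<bar>"
  shows "(a\<^sup>2 / 4 > b \<longrightarrow>
           (ode_solution a b y \<longleftrightarrow>
             (\<exists>C1 C2 :: real. \<forall>x. y x = exp (- \<alpha> * x) * (C1 * cosh (\<beta> * x) + C2 * sinh (\<beta> * x)))))
       \<and> (a\<^sup>2 / 4 = b \<longrightarrow>
           (ode_solution a b y \<longleftrightarrow>
             (\<exists>C1 C2 :: real. \<forall>x. y x = exp (- \<alpha> * x) * (C1 + C2 * x))))
       \<and> (a\<^sup>2 / 4 < b \<longrightarrow>
           (ode_solution a b y \<longleftrightarrow>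
             (\<exists>C1 C2 :: real. \<forall>x. y x = exp (- \<alpha> * x) * (C1 * cos (\<beta> * x) + C2 * sin (\<beta> * x)))))"
proof (intro conjI impI)
  have a: "a = 2 * \<alpha>" using assms(1) by simp
  have \<alpha>2: "\<alpha>\<^sup>2 = a\<^sup>2 / 4" by (simp add: a power_mult_distrib)
  have \<beta>2: "\<beta>\<^sup>2 = \<bar>a\<^sup>2 / 4 - b\<bar>" using assms(2) by simp
  {
    assume less: "a\<^sup>2 / 4 > b"
    then have \<beta>: "\<beta> \<noteq> 0" using assms(2) by simp
    have b: "b = \<alpha>\<^sup>2 - \<beta>\<^sup>2" using less \<alpha>2 \<beta>2 by simp
    \<comment> \<open>Here \<open>k\<close> is the square of \<beta>, and \<open>wronskian\<close>
      becomes the hyperbolic Pythagorean identity.\<close>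
    have "ode_solution a b y \<longleftrightarrow>
      (\<exists>C1 C2. \<forall>x. y x = exp (- \<alpha> * x) * (C1 * cosh (\<beta> * x) + C2 * (sinh (\<beta> * x) / \<beta>)))"
      using \<beta>
      by (intro ode_solution_iff_fundamental_system[OF a b])
        (auto intro!: derivative_eq_intros
          simp: power_divide power2_eq_square[of \<beta>] hyperbolic_pythagoras)
    then show "ode_solution a b y \<longleftrightarrow>
      (\<exists>C1 C2. \<forall>x. y x = exp (- \<alpha> * x) * (C1 * cosh (\<beta> * x) + C2 * sinh (\<beta> * x)))"
      by (simp only: ex_scaled_coefficient[OF \<beta>])
  next
    assume "a\<^sup>2 / 4 = b"
    \<comment> \<open>The term \<open>- 0\<close> exhibits \<open>k = 0\<close>; then the pair
      \<open>c = 1\<close>, \<open>s = x\<close> is used, hence \<open>C1 * 1\<close> below.\<close>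
    then have b: "b = \<alpha>\<^sup>2 - 0" using \<alpha>2 by simp
    have "ode_solution a b y \<longleftrightarrow>
      (\<exists>C1 C2. \<forall>x. y x = exp (- \<alpha> * x) * (C1 * 1 + C2 * x))"
      by (intro ode_solution_iff_fundamental_system[OF a b]) (auto intro!: derivative_eq_intros)
    then show "ode_solution a b y \<longleftrightarrow> (\<exists>C1 C2. \<forall>x. y x = exp (- \<alpha> * x) * (C1 + C2 * x))"
      by simp
  next
    assume less: "a\<^sup>2 / 4 < b"
    then have \<beta>: "\<beta> \<noteq> 0" using assms(2) by simp
    \<comment> \<open>Now \<open>k\<close> is minus the square of \<beta>, so
      \<open>wronskian\<close> for cos and the rescaled sin is the circular Pythagorean
      identity.\<close>
    have b: "b = \<alpha>\<^sup>2 - (- \<beta>\<^sup>2)" using less \<alpha>2 \<beta>2 by simp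
    have "ode_solution a b y \<longleftrightarrow>
      (\<exists>C1 C2. \<forall>x. y x = exp (- \<alpha> * x) * (C1 * cos (\<beta> * x) + C2 * (sin (\<beta> * x) / \<beta>)))"
      using \<beta>
      by (intro ode_solution_iff_fundamental_system[OF a b])
        (auto intro!: derivative_eq_intros simp: power_divide power2_eq_square[of \<beta>])
    then show "ode_solution a b y \<longleftrightarrow>
      (\<exists>C1 C2. \<forall>x. y x = exp (- \<alpha> * x) * (C1 * cos (\<beta> * x) + C2 * sin (\<beta> * x)))"
      by (simp only: ex_scaled_coefficient[OF \<beta>])
  }
qed

end
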